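(* Let $(V,\omega)$ be a $\mathbb{Z}$-graded conformal vertex algebra over $\mathbb{K}$. The map $\phi:\mathrm{Aut}^{+}V\to CV^{+}$, $f\mapsto f(\omega)$, is a bijection. Its inverse is the map $a\mapsto\psi_a$, where for $a\in CV^{+}$, $\psi_a$ denotes the unique element of $\mathrm{Aut}^{+}V$ with $\psi_a(\omega)=a$.
   Context: The base field $\mathbb{K}$ is $\mathbb{R}$ or $\mathbb{C}$. For a vertex algebra $V$ over $\mathbb{K}$ with vacuum vector $\mathbf{1}$, $a(n)b$ denotes the $n$-th product ($n\in\mathbb{Z}$), $a(n)\in\mathrm{End}\,V$, and $Ta=a(-2)\mathbf{1}$. A $\mathbb{Z}$-graded vertex algebra is a vertex algebra $V=\bigoplus_{n\in\mathbb{Z}}V_n$ with $V_n(k)V_m\subset V_{n+m-k-1}$ and $\mathbf{1}\in V_0$. A $\mathbb{Z}$-graded conformal vertex algebra $(V,\omega)$ is a $\mathbb{Z}$-graded vertex algebra with a distinguished $\omega\in V_2$ such that the operators $L(n)=\omega(n+1)$ satisfy $[L(n),L(m)]=(n-m)L(n+m)+\frac{1}{12}\delta_{n+m,0}(n^3-n)c$ for some $c\in\mathbb{K}$, $L(0)v=nv$ for $v\in V_n$, and $L(-1)=T$. $CV$ is the set of conformal vectors of $V$, i.e. of $a\in V$ such that $(V,a)$, with grading $V=\bigoplus_{n\in\mathbb{Z}}V_n^a$, $V_n^a=\{v\in V\mid a(1)v=nv\}$, is a $\mathbb{Z}$-graded conformal vertex algebra. $\mathrm{pr}_n:V\to V_n$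 is the canonical projection, $V_{\ge n}=\bigoplus_{i\ge n}V_i$, and $CV^{+}=\{a\in CV\cap V_{\ge2}\mid\mathrm{pr}_2(a)=\omega\}$. $\mathrm{Aut}\,V$ is the group of vertex algebra automorphisms (linear isomorphisms $f$ with $f(a(n)b)=f(a)(n)f(b)$ and $f(\mathbf{1})=\mathbf{1}$), and $\mathrm{Aut}^{+}V=\{f\in\mathrm{Aut}\,V\mid f(V_n)\subset V_{\ge n}\text{ and }\mathrm{pr}_n\circ f|_{V_n}=\mathrm{id}_{V_n}\text{ for all }n\in\mathbb{Z}\}$. *)

theory Defs
  imports Complex_Main "HOL-Library.Groups_Big_Fun"
begin

text \<open>
  The underlying set of a vertex algebra is a whole type; \<open>nprod a n b\<close> is the \<open>n\<close>-th product
  \<open>a(n)b\<close>. The Borcherds identity is written as an identity of endomorphisms applied to \<open>c\<close>.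
  By \<open>truncation\<close> and linearity, only finitely many summands on each side are nonzero, so that
  \<^const>\<open>Sum_any\<close> (which is \<open>0\<close> on families of infinite support) is the intended sum over
  \<open>i \<ge> 0\<close>.
\<close>

locale vertex_algebra = vector_space scale
  for scale :: "'k::field_char_0 \<Rightarrow> 'a::ab_group_add \<Rightarrow> 'a" +
  fixes vac :: 'a
    and nprod :: "'a \<Rightarrow> int \<Rightarrow> 'a \<Rightarrow> 'a"
  assumes linear_right: "Vector_Spaces.linear scale scale (\<lambda>b. nprod a n b)"
    and linear_left: "Vector_Spaces.linear scale scale (\<lambda>a. nprod a n b)"
    and truncation: "\<exists>N. \<forall>n\<ge>N. nprod a n b = 0"
    and vacuum_left: "nprod vac n a = (if n = -1 then a else 0)"
    and vacuum_right: "n \<ge> 0 \<Longrightarrow> nprod a n vac = 0"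
    and creation: "nprod a (-1) vac = a"
    and borcherds:
      "Sum_any (\<lambda>i::nat. scale (of_int p gchoose i)
          (nprod (nprod a (r + int i) b) (p + q - int i) c)) =
       Sum_any (\<lambda>i::nat. scale ((-1) ^ i * (of_int r gchoose i))
          (nprod a (p + r - int i) (nprod b (q + int i) c)
           - scale ((-1) powi r) (nprod b (q + r - int i) (nprod a (p + int i) c))))"
begin

definition T :: "'a \<Rightarrow> 'a" where
  "T a = nprod a (-2) vac"

definition Aut :: "('a \<Rightarrow> 'a) set" where
  "Aut = {f. Vector_Spaces.linear scale scale f \<and> bij f \<and>
             (\<forall>a n b. f (nprod a n b) = nprod (f a) n (f b)) \<and> f vac = vac}"

end

definition is_decomposition :: "(int \<Rightarrow> 'a::comm_monoid_add set) \<Rightarrow> 'a \<Rightarrow> (int \<Rightarrow> 'a) \<Rightarrow> bool" where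
  "is_decomposition V v x \<longleftrightarrow> (\<forall>n. x n \<in> V n) \<and> finite {n. x n \<noteq> 0} \<and> v = Sum_any x"

locale Z_graded_vertex_algebra = vertex_algebra scale vac nprod
  for scale :: "'k::field_char_0 \<Rightarrow> 'a::ab_group_add \<Rightarrow> 'a"
    and vac :: 'a
    and nprod :: "'a \<Rightarrow> int \<Rightarrow> 'a \<Rightarrow> 'a" +
  fixes V :: "int \<Rightarrow> 'a set"
  assumes subspace_graded: "subspace (V n)"
    and direct_sum: "\<exists>!x. is_decomposition V v x"
    and nprod_graded: "\<lbrakk>a \<in> V n; b \<in> V m\<rbrakk> \<Longrightarrow> nprod a k b \<in> V (n + m - k - 1)"
    and vac_graded: "vac \<in> V 0"
begin

definition pr :: "int \<Rightarrow> 'a \<Rightarrow> 'a" where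
  "pr n v = (THE x. is_decomposition V v x) n"

definition V_ge :: "int \<Rightarrow> 'a set" where
  "V_ge n = span (\<Union>i\<in>{n..}. V i)"

definition Aut_plus :: "('a \<Rightarrow> 'a) set" where
  "Aut_plus = {f \<in> Aut. \<forall>n. f ` V n \<subseteq> V_ge n \<and> (\<forall>v\<in>V n. pr n (f v) = v)}"

end

locale Z_graded_conformal_vertex_algebra = Z_graded_vertex_algebra scale vac nprod V
  for scale :: "'k::field_char_0 \<Rightarrow> 'a::ab_group_add \<Rightarrow> 'a"
    and vac :: 'a
    and nprod :: "'a \<Rightarrow> int \<Rightarrow> 'a \<Rightarrow> 'a"
    and V :: "int \<Rightarrow> 'a set" +
  fixes \<omega> :: 'a
  assumes conformal_graded: "\<omega> \<in> V 2"
    and virasoro: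
      "\<exists>c::'k. \<forall>n m v.
         nprod \<omega> (n + 1) (nprod \<omega> (m + 1) v) - nprod \<omega> (m + 1) (nprod \<omega> (n + 1) v) =
         scale (of_int (n - m)) (nprod \<omega> (n + m + 1) v) +
         scale (1 / 12 * (if n + m = 0 then 1 else 0) * of_int (n ^ 3 - n) * c) v"
    and L0_graded: "v \<in> V n \<Longrightarrow> nprod \<omega> 1 v = scale (of_int n) v"
    and Lm1_eq_T: "nprod \<omega> 0 v = T v"

context vertex_algebra
begin

definition eigen_grading :: "'a \<Rightarrow> int \<Rightarrow> 'a set" where
  "eigen_grading a n = {v. nprod a 1 v = scale (of_int n) v}"

definition CV :: "'a set" where
  "CV = {a. Z_graded_conformal_vertex_algebra scale vac nprod (eigen_grading a) a}"

end

context Z_graded_conformal_vertex_algebra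
begin

definition CV_plus :: "'a set" where
  "CV_plus = {a \<in> CV \<inter> V_ge 2. pr 2 a = \<omega>}"

definition \<phi> :: "('a \<Rightarrow> 'a) \<Rightarrow> 'a" where
  "\<phi> f = f \<omega>"

definition \<psi> :: "'a \<Rightarrow> 'a \<Rightarrow> 'a" where
  "\<psi> a = (THE f. f \<in> Aut_plus \<and> f \<omega> = a)"

end

end

theory Submission imports Defs begin

text \<open>
  The argument works with leading terms for the descending filtration by the subspaces
  \<open>V\<^bsub>\<ge>n\<^esub>\<close>. This filtration is exhaustive and separated, since every vector has only finitely
  many nonzero components; no lower bound on the degrees is needed. The product of the leading
  terms of \<open>x\<close> and \<open>y\<close> is the component of \<open>x(k)y\<close> in the lowest possible degree
  (\<open>pr_nprod_leading\<close>).

  Let \<open>a \<in> V\<^bsub>\<ge>2\<^esub>\<close> have leading term \<open>\<omega>\<close>. Then \<open>a(1)\<close> preserves the filtration and acts as \<open>L(0)\<close>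
  on leading terms, so that a nonzero eigenvector of \<open>a(1)\<close> with eigenvalue \<open>n\<close> has its leading
  term in degree \<open>n\<close>. In other words, the eigenspace \<open>V\<^sup>a\<^sub>n\<close> lies in \<open>V\<^bsub>\<ge>n\<^esub>\<close> and meets
  \<open>V\<^bsub>\<ge>n+1\<^esub>\<close> trivially (\<open>eigen_grading_subset_V_ge\<close>, \<open>eigenvector_eq_0\<close>).

  If \<open>f \<in> Aut\<^sup>+ V\<close>, then \<open>f(\<omega>) \<in> CV\<^sup>+\<close> by transport of structure: the eigenspaces of \<open>f(\<omega>)(1)\<close> are
  the images \<open>f(V\<^sub>n)\<close>.

  Injectivity of \<open>f \<mapsto> f(\<omega>)\<close>: if \<open>f\<close> and \<open>g\<close> both send \<open>\<omega>\<close> to \<open>a\<close> and \<open>v \<in> V\<^sub>n\<close>, then \<open>f(v)\<close> and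
  \<open>g(v)\<close> are elements of \<open>V\<^sup>a\<^sub>n\<close> with the same leading term \<open>v\<close>, so they are equal.

  Surjectivity: if \<open>a \<in> CV\<^sup>+\<close>, the eigenspaces \<open>V\<^sup>a\<^sub>n\<close> form a second grading of the vertex algebra,
  and it induces the same filtration (\<open>compatible_gradings_eigen\<close>). Hence \<open>pr\<^sub>n\<close> restricts to a
  linear isomorphism \<open>V\<^sup>a\<^sub>n \<rightarrow> V\<^sub>n\<close>, inverse to the projection of \<open>V\<^sub>n\<close> to \<open>V\<^sup>a\<^sub>n\<close> for the second
  grading, and these inverses add up to a linear bijection \<open>f\<close> of \<open>V\<close>. It is multiplicative, because \<open>f(u)(k)f(v)\<close> and \<open>f(u(k)v)\<close> lie in the same
  eigenspace and have the same leading term \<open>u(k)v\<close>; it sends \<open>\<omega>\<close> to \<open>a\<close>, because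
  \<open>a \<in> V\<^sup>a\<^sub>2\<close> has leading term \<open>\<omega>\<close> (\<open>CV_plus_attained\<close>).
\<close>

section \<open>Homogeneous components and the degree filtration\<close>

context vertex_algebra
begin

interpretation endo: vector_space_pair scale scale ..

lemma nprod_add_left: "nprod (a + b) n c = nprod a n c + nprod b n c"
  using endo.linear_add[OF linear_left] .

lemma nprod_add_right: "nprod a n (b + c) = nprod a n b + nprod a n c"
  using endo.linear_add[OF linear_right] .

lemma nprod_scale_right: "nprod a n (scale r b) = scale r (nprod a n b)"
  using endo.linear_scale[OF linear_right] .

lemma subspace_eigen_grading: "subspace (eigen_grading a n)"
  unfolding eigen_grading_def
  by (rule subspaceI)
    (auto simp: endo.linear_0[OF linear_right] nprod_add_right nprod_scale_right
      scale_right_distrib scale_left_commute)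

end

context Z_graded_vertex_algebra
begin

interpretation endo: vector_space_pair scale scale ..

lemma is_decomposition_pr: "is_decomposition V v (\<lambda>n. pr n v)"
  using theI'[OF direct_sum, of v] unfolding pr_def .

lemma pr_eqI: "is_decomposition V v x \<Longrightarrow> pr n v = x n"
  using direct_sum is_decomposition_pr by metis

lemma pr_in: "pr n v \<in> V n"
  and finite_pr: "finite {n. pr n v \<noteq> 0}"
  and Sum_any_pr: "Sum_any (\<lambda>n. pr n v) = v"
  using is_decomposition_pr[of v] unfolding is_decomposition_def by auto

lemma sum_pr: "finite A \<Longrightarrow> {n. pr n v \<noteq> 0} \<subseteq> A \<Longrightarrow> (\<Sum>n\<in>A. pr n v) = v"
  using Sum_any.expand_superset[of A "\<lambda>n. pr n v"] Sum_any_pr by simp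

lemma pr_add: "pr n (u + v) = pr n u + pr n v"
proof (rule pr_eqI)
  have "finite {n. pr n u + pr n v \<noteq> 0}"
    by (rule finite_subset[OF _ finite_UnI[OF finite_pr[of u] finite_pr[of v]]]) auto
  then show "is_decomposition V (u + v) (\<lambda>n. pr n u + pr n v)"
    unfolding is_decomposition_def
    using Sum_any.distrib[OF finite_pr[of u] finite_pr[of v]]
    by (auto simp: Sum_any_pr subspace_add[OF subspace_graded] pr_in)
qed

lemma pr_scale: "pr n (scale r v) = scale r (pr n v)"
proof (rule pr_eqI)
  let ?A = "{n. pr n v \<noteq> 0}"
  have sub: "{n. scale r (pr n v) \<noteq> 0} \<subseteq> ?A" by auto
  have "Sum_any (\<lambda>n. scale r (pr n v)) = (\<Sum>n\<in>?A. scale r (pr n v))"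
    by (rule Sum_any.expand_superset[OF finite_pr sub])
  also have "\<dots> = scale r v"
    by (simp add: scale_sum_right[symmetric] sum_pr[OF finite_pr])
  finally show "is_decomposition V (scale r v) (\<lambda>n. scale r (pr n v))"
    unfolding is_decomposition_def
    using finite_subset[OF sub finite_pr]
    by (auto simp: subspace_scale[OF subspace_graded] pr_in)
qed

lemma linear_pr: "Vector_Spaces.linear scale scale (pr n)"
  by (simp add: Vector_Spaces.linear_iff vector_space_axioms pr_add pr_scale)

lemmas pr_0 = endo.linear_0[OF linear_pr]
lemmas pr_diff = endo.linear_diff[OF linear_pr]

lemma pr_graded: "v \<in> V n \<Longrightarrow> pr m v = (if m = n then v else 0)"
proof (rule pr_eqI)
  assume v: "v \<in> V n"
  have sub: "{m. (if m = n then v else 0) \<noteq> 0} \<subseteq> {n}" by auto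
  show "is_decomposition V v (\<lambda>m. if m = n then v else 0)"
    unfolding is_decomposition_def
    using v finite_subset[OF sub] Sum_any.expand_superset[OF _ sub]
    by (auto simp: subspace_0[OF subspace_graded])
qed

lemma V_ge_iff: "v \<in> V_ge n \<longleftrightarrow> (\<forall>m<n. pr m v = 0)"
proof
  have "subspace {v. \<forall>m<n. pr m v = 0}"
    by (rule subspaceI) (auto simp: pr_0 pr_add pr_scale)
  moreover have "(\<Union>i\<in>{n..}. V i) \<subseteq> {v. \<forall>m<n. pr m v = 0}"
    by (auto simp: pr_graded)
  ultimately have "V_ge n \<subseteq> {v. \<forall>m<n. pr m v = 0}"
    unfolding V_ge_def by (rule span_minimal[rotated])
  then show "v \<in> V_ge n \<Longrightarrow> \<forall>m<n. pr m v = 0" by blast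
next
  assume v: "\<forall>m<n. pr m v = 0"
  have "(\<Sum>i | pr i v \<noteq> 0. pr i v) \<in> V_ge n"
    unfolding V_ge_def
  proof (rule span_sum, rule span_base)
    fix i assume "i \<in> {i. pr i v \<noteq> 0}"
    then have "i \<ge> n" using v by (meson mem_Collect_eq not_le)
    then show "pr i v \<in> (\<Union>i\<in>{n..}. V i)" using pr_in by auto
  qed
  then show "v \<in> V_ge n" by (simp add: sum_pr[OF finite_pr])
qed

lemma graded_subset_V_ge: "V n \<subseteq> V_ge n"
  by (auto simp: V_ge_iff pr_graded)

lemma V_ge_antimono: "m \<le> n \<Longrightarrow> V_ge n \<subseteq> V_ge m"
  by (auto simp: V_ge_iff)

lemma subspace_V_ge: "subspace (V_ge n)"
  unfolding V_ge_def by (rule subspace_span)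

lemma V_ge_succ: "v \<in> V_ge n \<Longrightarrow> pr n v = 0 \<Longrightarrow> v \<in> V_ge (n + 1)"
  using zless_add1_eq by (auto simp: V_ge_iff)

lemma diff_pr_V_ge_succ: "v \<in> V_ge n \<Longrightarrow> v - pr n v \<in> V_ge (n + 1)"
  by (rule V_ge_succ) (auto simp: V_ge_iff pr_diff pr_graded[OF pr_in])

text \<open>The bound \<open>m \<le> n\<close> allows downward induction on \<open>m\<close> starting from \<open>n\<close>.\<close>

lemma V_ge_exhaustive: obtains m where "m \<le> n" "v \<in> V_ge m"
proof -
  let ?m = "Min (insert n {i. pr i v \<noteq> 0})"
  have "?m \<le> n" by (simp add: finite_pr)
  moreover have "v \<in> V_ge ?m"
    unfolding V_ge_iff using finite_pr[of v] by auto
  ultimately show ?thesis using that by blast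
qed

lemma V_ge_separated:
  assumes "\<And>m. m \<ge> n \<Longrightarrow> v \<in> V_ge m"
  shows "v = 0"
proof -
  have "pr i v = 0" for i
    using assms[of "max n (i + 1)"] by (auto simp: V_ge_iff)
  then show ?thesis using Sum_any_pr[of v] by simp
qed

lemma linear_eq_on_graded:
  assumes f: "Vector_Spaces.linear scale scale f" and g: "Vector_Spaces.linear scale scale g"
    and eq: "\<And>n v. v \<in> V n \<Longrightarrow> f v = g v"
  shows "f = g"
proof
  fix v
  have "f v = (\<Sum>n | pr n v \<noteq> 0. f (pr n v))"
    by (simp add: endo.linear_sum[OF f, symmetric] sum_pr[OF finite_pr])
  also have "\<dots> = (\<Sum>n | pr n v \<noteq> 0. g (pr n v))"
    by (simp add: eq[OF pr_in])
  also have "\<dots> = g v"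
    by (simp add: endo.linear_sum[OF g, symmetric] sum_pr[OF finite_pr])
  finally show "f v = g v" .
qed

lemma nprod_V_ge:
  assumes x: "x \<in> V_ge i" and y: "y \<in> V_ge j"
  shows "nprod x k y \<in> V_ge (i + j - k - 1)"
proof -
  have hom: "nprod u k v \<in> V_ge (i + j - k - 1)"
    if "u \<in> (\<Union>i\<in>{i..}. V i)" "v \<in> (\<Union>i\<in>{j..}. V i)" for u v
  proof -
    from that obtain i' j' where "i' \<ge> i" "u \<in> V i'" "j' \<ge> j" "v \<in> V j'" by auto
    then show ?thesis
      using nprod_graded[of u i' v j' k] graded_subset_V_ge[of "i' + j' - k - 1"]
        V_ge_antimono[of "i + j - k - 1" "i' + j' - k - 1"] by auto
  qed
  have left: "nprod u k y \<in> V_ge (i + j - k - 1)" if "u \<in> (\<Union>i\<in>{i..}. V i)" for u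
    using endo.linear_subspace_vimage[OF linear_right subspace_V_ge]
      span_minimal[of _ "(\<lambda>b. nprod u k b) -` V_ge (i + j - k - 1)"] hom[OF that] y
    unfolding V_ge_def[of j] by blast
  show ?thesis
    using endo.linear_subspace_vimage[OF linear_left subspace_V_ge]
      span_minimal[of _ "(\<lambda>a. nprod a k y) -` V_ge (i + j - k - 1)"] left x
    unfolding V_ge_def[of i] by blast
qed

text \<open>The \<open>k\<close>-th product is compatible with the filtration and is computed on leading terms by
  the product of the leading components. (Either of these may be zero.)\<close>

lemma pr_nprod_leading:
  assumes x: "x \<in> V_ge i" and y: "y \<in> V_ge j"
  shows "pr (i + j - k - 1) (nprod x k y) = nprod (pr i x) k (pr j y)"
proof -
  let ?d = "i + j - k - 1"
  have "nprod (x - pr i x) k y \<in> V_ge (?d + 1)"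
    using nprod_V_ge[OF diff_pr_V_ge_succ[OF x] y, of k] by (simp add: algebra_simps)
  moreover have "nprod (pr i x) k (y - pr j y) \<in> V_ge (?d + 1)"
    using nprod_V_ge[OF _ diff_pr_V_ge_succ[OF y], of "pr i x" i k] pr_in graded_subset_V_ge
    by (auto simp: algebra_simps)
  moreover have "nprod x k y =
      nprod (x - pr i x) k y + nprod (pr i x) k (y - pr j y) + nprod (pr i x) k (pr j y)"
    by (simp add: nprod_add_left[symmetric] nprod_add_right[symmetric] add.assoc)
  moreover have "pr ?d (nprod (pr i x) k (pr j y)) = nprod (pr i x) k (pr j y)"
    using pr_graded[OF nprod_graded[OF pr_in pr_in], of ?d] by simp
  ultimately show ?thesis by (simp add: pr_add V_ge_iff)
qed

end

section \<open>Two gradings with the same filtration\<close>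

text \<open>Two gradings \<open>V\<close> and \<open>W\<close> of one vertex algebra, each contained degreewise in the filtration
  of the other. This is equivalent to equality of the two filtrations, and it is symmetric in
  \<open>V\<close> and \<open>W\<close>.\<close>

locale compatible_gradings =
  V: Z_graded_vertex_algebra scale vac nprod V + W: Z_graded_vertex_algebra scale vac nprod W
  for scale :: "'k::field_char_0 \<Rightarrow> 'a::ab_group_add \<Rightarrow> 'a" and vac nprod V W +
  assumes V_sub: "V n \<subseteq> W.V_ge n" and W_sub: "W n \<subseteq> V.V_ge n"
begin

interpretation endo: vector_space_pair scale scale ..

text \<open>The linear map whose restriction to \<open>V\<^sub>n\<close> is the projection to \<open>W\<^sub>n\<close>. The family under the sum
  has finite support, so \<^const>\<open>Sum_any\<close> does not take its default value.\<close>

definition transfer :: "'a \<Rightarrow> 'a" where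
  "transfer v = Sum_any (\<lambda>n. W.pr n (V.pr n v))"

lemma transfer_eq_sum:
  assumes "finite A" "{n. V.pr n v \<noteq> 0} \<subseteq> A"
  shows "transfer v = (\<Sum>n\<in>A. W.pr n (V.pr n v))"
  unfolding transfer_def
  by (rule Sum_any.expand_superset) (use assms in \<open>auto simp: W.pr_0\<close>)

lemma transfer_graded: "v \<in> V n \<Longrightarrow> transfer v = W.pr n v"
  by (subst transfer_eq_sum[of "{n}"]) (auto simp: V.pr_graded)

lemma linear_transfer: "Vector_Spaces.linear scale scale transfer"
  unfolding Vector_Spaces.linear_iff
proof (intro conjI allI V.vector_space_axioms)
  fix u v
  let ?A = "{n. V.pr n u \<noteq> 0} \<union> {n. V.pr n v \<noteq> 0}"
  have fin: "finite ?A" by (simp add: V.finite_pr)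
  have "transfer (u + v) = (\<Sum>n\<in>?A. W.pr n (V.pr n (u + v)))"
    by (rule transfer_eq_sum[OF fin]) (auto simp: V.pr_add)
  also have "\<dots> = transfer u + transfer v"
    using transfer_eq_sum[OF fin, of u] transfer_eq_sum[OF fin, of v]
    by (auto simp: V.pr_add W.pr_add sum.distrib)
  finally show "transfer (u + v) = transfer u + transfer v" .
next
  fix r v
  let ?A = "{n. V.pr n v \<noteq> 0}"
  have "transfer (scale r v) = (\<Sum>n\<in>?A. W.pr n (V.pr n (scale r v)))"
    by (rule transfer_eq_sum[OF V.finite_pr]) (auto simp: V.pr_scale)
  then show "transfer (scale r v) = scale r (transfer v)"
    using transfer_eq_sum[OF V.finite_pr subset_refl, of v]
    by (simp add: V.pr_scale W.pr_scale V.scale_sum_right)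
qed

lemma transfer_in: "v \<in> V n \<Longrightarrow> transfer v \<in> W n"
  using W.pr_in by (simp add: transfer_graded)

lemma W_ge_subset_V_ge: "W.V_ge n \<subseteq> V.V_ge n"
  unfolding W.V_ge_def
  using W_sub V.V_ge_antimono by (intro V.span_minimal V.subspace_V_ge) fastforce

text \<open>On \<open>V\<^sub>n\<close>, the projection to \<open>W\<^sub>n\<close> only changes components of higher degree; hence the
  projections \<open>V\<^sub>n \<rightarrow> W\<^sub>n\<close> and \<open>W\<^sub>n \<rightarrow> V\<^sub>n\<close> are mutually inverse.\<close>

lemma pr_transfer:
  assumes v: "v \<in> V n"
  shows "V.pr n (transfer v) = v"
proof -
  have "v - W.pr n v \<in> V.V_ge (n + 1)"
    using W.diff_pr_V_ge_succ V_sub v W_ge_subset_V_ge by blast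
  then show ?thesis
    using v by (auto simp: transfer_graded V.V_ge_iff V.pr_diff V.pr_graded dest: spec[of _ n])
qed

lemma eq_if_pr_eq:
  assumes "w \<in> W n" "w' \<in> W n" "V.pr n w = V.pr n w'"
  shows "w = w'"
proof -
  interpret swap: compatible_gradings scale vac nprod W V
    by unfold_locales (rule W_sub V_sub)+
  have "swap.transfer w = swap.transfer w'"
    using assms by (simp add: swap.transfer_graded)
  then show ?thesis
    using swap.pr_transfer assms by metis
qed

lemma bij_transfer: "bij transfer"
proof -
  interpret swap: compatible_gradings scale vac nprod W V
    by unfold_locales (rule W_sub V_sub)+
  have "swap.transfer \<circ> transfer = id"
  proof (rule V.linear_eq_on_graded)
    show "Vector_Spaces.linear scale scale (swap.transfer \<circ> transfer)"
      by (rule Vector_Spaces.linear_compose[OF linear_transfer swap.linear_transfer])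
    show "(swap.transfer \<circ> transfer) v = id v" if "v \<in> V n" for n v
      using that by (simp add: swap.transfer_graded[OF transfer_in] pr_transfer)
  qed (rule V.linear_id)
  moreover have "transfer \<circ> swap.transfer = id"
  proof (rule W.linear_eq_on_graded)
    show "Vector_Spaces.linear scale scale (transfer \<circ> swap.transfer)"
      by (rule Vector_Spaces.linear_compose[OF swap.linear_transfer linear_transfer])
    show "(transfer \<circ> swap.transfer) v = id v" if "v \<in> W n" for n v
      using that by (simp add: transfer_graded[OF swap.transfer_in] swap.pr_transfer)
  qed (rule V.linear_id)
  ultimately show ?thesis by (rule o_bij)
qed

text \<open>Both sides are homogeneous of the same degree for \<open>W\<close> and have the same leading term for
  \<open>V\<close>.\<close>

lemma transfer_nprod_graded:
  assumes u: "u \<in> V i" and v: "v \<in> V j"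
  shows "transfer (nprod u k v) = nprod (transfer u) k (transfer v)"
proof (rule eq_if_pr_eq)
  let ?d = "i + j - k - 1"
  show "transfer (nprod u k v) \<in> W ?d"
    using u v by (intro transfer_in V.nprod_graded)
  show "nprod (transfer u) k (transfer v) \<in> W ?d"
    using u v by (intro W.nprod_graded transfer_in)
  have "V.pr ?d (nprod (transfer u) k (transfer v))
      = nprod (V.pr i (transfer u)) k (V.pr j (transfer v))"
    using V.pr_nprod_leading transfer_in[OF u] transfer_in[OF v] W_sub by blast
  then show "V.pr ?d (transfer (nprod u k v)) = V.pr ?d (nprod (transfer u) k (transfer v))"
    using pr_transfer[OF V.nprod_graded[OF u v]] u v by (simp add: pr_transfer)
qed

lemma transfer_nprod: "transfer (nprod u k v) = nprod (transfer u) k (transfer v)"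
proof -
  note compose = Vector_Spaces.linear_compose[unfolded comp_def]
  have right: "transfer (nprod u k v) = nprod (transfer u) k (transfer v)" if "u \<in> V i" for i u v
    by (rule fun_cong[of _ _ v], rule V.linear_eq_on_graded)
      (auto intro: compose[OF V.linear_right linear_transfer]
         compose[OF linear_transfer V.linear_right] transfer_nprod_graded that)
  show ?thesis
    by (rule fun_cong[of _ _ u], rule V.linear_eq_on_graded)
      (auto intro: compose[OF V.linear_left linear_transfer]
         compose[OF linear_transfer V.linear_left] right)
qed

lemma transfer_in_Aut_plus: "transfer \<in> V.Aut_plus"
proof -
  have "transfer vac = vac"
    by (simp add: transfer_graded[OF V.vac_graded] W.pr_graded[OF W.vac_graded])
  then have "transfer \<in> V.Aut"
    unfolding V.Aut_def using linear_transfer bij_transfer transfer_nprod by blast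
  then show ?thesis
    unfolding V.Aut_plus_def using transfer_in W_sub pr_transfer by blast
qed

end

section \<open>Eigenspaces of conformal vectors\<close>

context vertex_algebra
begin

interpretation endo: vector_space_pair scale scale ..

text \<open>Transport of structure: an automorphism carries a conformal structure, given by a grading and
  a conformal vector, to another one.\<close>

lemma Z_graded_conformal_image:
  assumes f: "f \<in> Aut" and conf: "Z_graded_conformal_vertex_algebra scale vac nprod V \<omega>"
  shows "Z_graded_conformal_vertex_algebra scale vac nprod (\<lambda>n. f ` V n) (f \<omega>)"
proof -
  interpret V: Z_graded_conformal_vertex_algebra scale vac nprod V \<omega> by (rule conf)
  have lin: "Vector_Spaces.linear scale scale f" and bij: "bij f"
    and hom: "\<And>a n b. f (nprod a n b) = nprod (f a) n (f b)" and vac: "f vac = vac"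
    using f by (auto simp: Aut_def)
  have f0: "f x = 0 \<longleftrightarrow> x = 0" for x
    using inj_eq[OF bij_is_inj[OF bij], of x 0] endo.linear_0[OF lin] by simp
  have decomp: "is_decomposition (\<lambda>n. f ` V n) (f v) (\<lambda>n. f (x n)) \<longleftrightarrow> is_decomposition V v x"
    for v x
  proof (cases "finite {n. x n \<noteq> 0}")
    case True
    have "Sum_any (\<lambda>n. f (x n)) = f (Sum_any x)"
      by (simp add: Sum_any.expand_set f0 endo.linear_sum[OF lin])
    then show ?thesis
      using bij by (auto simp: is_decomposition_def f0 bij_is_inj inj_image_mem_iff inj_eq)
  qed (simp add: is_decomposition_def f0)
  define g where "g = inv f"
  have fg: "f (g v) = v" for v
    unfolding g_def by (rule surj_f_inv_f[OF bij_is_surj[OF bij]])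
  show ?thesis
  proof unfold_locales
    show "subspace (f ` V n)" for n
      by (rule endo.linear_subspace_image[OF lin V.subspace_graded])
    show "\<exists>!x. is_decomposition (\<lambda>n. f ` V n) v x" for v
    proof -
      show ?thesis
      proof (rule ex1I)
        show "is_decomposition (\<lambda>n. f ` V n) v (\<lambda>n. f (V.pr n (g v)))"
          using decomp[of "g v" "\<lambda>n. V.pr n (g v)"] V.is_decomposition_pr by (simp add: fg)
        show "y = (\<lambda>n. f (V.pr n (g v)))" if "is_decomposition (\<lambda>n. f ` V n) v y" for y
          using that decomp[of "g v" "\<lambda>n. g (y n)"] by (simp add: fg V.pr_eqI)
      qed
    qed
    show "nprod a k b \<in> f ` V (n + m - k - 1)" if "a \<in> f ` V n" "b \<in> f ` V m" for a b n m k
      using that V.nprod_graded by (auto simp: hom[symmetric])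
    show "vac \<in> f ` V 0" using V.vac_graded vac by force
    show "f \<omega> \<in> f ` V 2" using V.conformal_graded by blast
    obtain c where c: "\<And>n m v.
         nprod \<omega> (n + 1) (nprod \<omega> (m + 1) v) - nprod \<omega> (m + 1) (nprod \<omega> (n + 1) v) =
         scale (of_int (n - m)) (nprod \<omega> (n + m + 1) v) +
         scale (1 / 12 * (if n + m = 0 then 1 else 0) * of_int (n ^ 3 - n) * c) v"
      using V.virasoro by blast
    have "nprod (f \<omega>) (n + 1) (nprod (f \<omega>) (m + 1) v)
           - nprod (f \<omega>) (m + 1) (nprod (f \<omega>) (n + 1) v) =
         scale (of_int (n - m)) (nprod (f \<omega>) (n + m + 1) v) +
         scale (1 / 12 * (if n + m = 0 then 1 else 0) * of_int (n ^ 3 - n) * c) v" for n m v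
      using arg_cong[OF c[of n m "g v"], of f]
      unfolding endo.linear_add[OF lin] endo.linear_diff[OF lin] endo.linear_scale[OF lin] hom fg .
    then show "\<exists>c. \<forall>n m v. nprod (f \<omega>) (n + 1) (nprod (f \<omega>) (m + 1) v)
           - nprod (f \<omega>) (m + 1) (nprod (f \<omega>) (n + 1) v) =
         scale (of_int (n - m)) (nprod (f \<omega>) (n + m + 1) v) +
         scale (1 / 12 * (if n + m = 0 then 1 else 0) * of_int (n ^ 3 - n) * c) v"
      by blast
    show "nprod (f \<omega>) 1 v = scale (of_int n) v" if "v \<in> f ` V n" for v n
      using that V.L0_graded
      by (auto simp: hom[symmetric] endo.linear_scale[OF lin, symmetric])
    show "nprod (f \<omega>) 0 v = T v" for v
      using arg_cong[OF V.Lm1_eq_T[of "g v"], of f] by (simp add: hom fg vac T_def)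
  qed
qed

lemma eigen_grading_image:
  assumes f: "f \<in> Aut"
  shows "eigen_grading (f a) n = f ` eigen_grading a n"
proof -
  have lin: "Vector_Spaces.linear scale scale f" and bij: "bij f"
    and hom: "\<And>a n b. f (nprod a n b) = nprod (f a) n (f b)"
    using f by (auto simp: Aut_def)
  have iff: "f v \<in> eigen_grading (f a) n \<longleftrightarrow> v \<in> eigen_grading a n" for v
    using bij unfolding eigen_grading_def
    by (simp add: hom[symmetric] endo.linear_scale[OF lin, symmetric] bij_is_inj inj_eq)
  show ?thesis
  proof (intro subset_antisym subsetI)
    fix w assume "w \<in> eigen_grading (f a) n"
    moreover obtain v where "w = f v" using surjD[OF bij_is_surj[OF bij]] by blast
    ultimately show "w \<in> f ` eigen_grading a n" using iff by blast
  qed (use iff in blast)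
qed

end

context Z_graded_conformal_vertex_algebra
begin

text \<open>The operator \<open>a(1)\<close> multiplies the degree \<open>m\<close> component of a vector of \<open>V\<^bsub>\<ge>m\<^esub>\<close> by \<open>m\<close>, so an
  eigenvector with eigenvalue \<open>n \<noteq> m\<close> has no such component. Raising \<open>m\<close> step by
  step up to \<open>n\<close>, or from \<open>n + 1\<close> without end, gives the next two lemmas.\<close>

lemma eigenvector_V_ge_succ:
  assumes a: "a \<in> V_ge 2" "pr 2 a = \<omega>"
    and v: "v \<in> eigen_grading a n" "v \<in> V_ge m" and "m \<noteq> n"
  shows "v \<in> V_ge (m + 1)"
proof (rule V_ge_succ[OF v(2)])
  have "scale (of_int n) (pr m v) = pr m (nprod a 1 v)"
    using v(1) by (simp add: eigen_grading_def pr_scale)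
  also have "\<dots> = nprod \<omega> 1 (pr m v)"
    using pr_nprod_leading[OF a(1) v(2), of 1] a(2) by simp
  also have "\<dots> = scale (of_int m) (pr m v)"
    by (rule L0_graded[OF pr_in])
  finally show "pr m v = 0" using \<open>m \<noteq> n\<close> by simp
qed

lemma eigen_grading_subset_V_ge:
  assumes a: "a \<in> V_ge 2" "pr 2 a = \<omega>"
  shows "eigen_grading a n \<subseteq> V_ge n"
proof
  fix v assume v: "v \<in> eigen_grading a n"
  obtain m where "m \<le> n" "v \<in> V_ge m" by (rule V_ge_exhaustive)
  then show "v \<in> V_ge n"
  proof (induction m rule: int_le_induct)
    case (step i)
    show ?case
    proof (rule step.IH)
      show "v \<in> V_ge i" using eigenvector_V_ge_succ[OF a v step.prems] step.hyps by simp
    qed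
  qed
qed

lemma eigenvector_eq_0:
  assumes a: "a \<in> V_ge 2" "pr 2 a = \<omega>"
    and v: "v \<in> eigen_grading a n" "v \<in> V_ge (n + 1)"
  shows "v = 0"
proof (rule V_ge_separated)
  show "v \<in> V_ge m" if "m \<ge> n + 1" for m
    using that
  proof (induction m rule: int_ge_induct)
    case base
    show ?case by (rule v(2))
  next
    case (step i)
    then show ?case using eigenvector_V_ge_succ[OF a v(1), of i] by simp
  qed
qed

text \<open>The grading of a conformal vertex algebra is determined by its conformal vector.\<close>

lemma eigen_grading_conformal: "eigen_grading \<omega> n = V n"
proof
  show "V n \<subseteq> eigen_grading \<omega> n"
    by (auto simp: eigen_grading_def L0_graded)
  have \<omega>: "\<omega> \<in> V_ge 2" "pr 2 \<omega> = \<omega>"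
    using conformal_graded graded_subset_V_ge by (auto simp: pr_graded)
  show "eigen_grading \<omega> n \<subseteq> V n"
  proof
    fix v assume v: "v \<in> eigen_grading \<omega> n"
    have "pr n v \<in> eigen_grading \<omega> n"
      using \<open>V n \<subseteq> eigen_grading \<omega> n\<close> pr_in by blast
    then have "v - pr n v \<in> eigen_grading \<omega> n"
      using v subspace_diff[OF subspace_eigen_grading] by blast
    moreover have "v - pr n v \<in> V_ge (n + 1)"
      using v eigen_grading_subset_V_ge[OF \<omega>] by (blast intro: diff_pr_V_ge_succ)
    ultimately have "v - pr n v = 0" by (rule eigenvector_eq_0[OF \<omega>])
    then show "v \<in> V n" using pr_in[of n v] by simp
  qed
qed

lemma compatible_gradings_eigen:
  assumes a: "a \<in> CV_plus"
  shows "compatible_gradings scale vac nprod V (eigen_grading a)"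
proof -
  have lead: "a \<in> V_ge 2" "pr 2 a = \<omega>" using a by (auto simp: CV_plus_def)
  interpret W: Z_graded_conformal_vertex_algebra scale vac nprod "eigen_grading a" a
    using a by (auto simp: CV_plus_def CV_def)
  note W_sub = eigen_grading_subset_V_ge[OF lead]
  have ge_sub: "W.V_ge n \<subseteq> V_ge n" for n
    unfolding W.V_ge_def
    using W_sub V_ge_antimono by (intro span_minimal subspace_V_ge) fastforce
  \<comment> \<open>The eigencomponents of \<open>v \<in> V\<^sub>n\<close> with eigenvalue below \<open>n\<close> vanish one after another, from the
    lowest upwards: if \<open>i - 1 < n\<close> is the lowest eigenvalue that is left, then \<open>v\<close> and the sum of
    the other components lie in \<open>V\<^bsub>\<ge>i\<^esub>\<close>, so the component of eigenvalue \<open>i - 1\<close> does too and is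
    zero.\<close>
  have "v \<in> W.V_ge n" if v: "v \<in> V n" for v n
  proof -
    obtain m where "m \<le> n" "v \<in> W.V_ge m" by (rule W.V_ge_exhaustive)
    then show ?thesis
    proof (induction m rule: int_le_induct)
      case (step i)
      have "v - W.pr (i - 1) v \<in> V_ge i"
        using W.diff_pr_V_ge_succ[OF step.prems] ge_sub by auto
      moreover have "v \<in> V_ge i"
        using v graded_subset_V_ge V_ge_antimono[OF step.hyps] by blast
      ultimately have "W.pr (i - 1) v \<in> V_ge i"
        using subspace_diff[OF subspace_V_ge, of v i "v - W.pr (i - 1) v"] by simp
      then have "W.pr (i - 1) v = 0"
        using eigenvector_eq_0[OF lead W.pr_in] by simp
      then show ?case using step.IH W.V_ge_succ[OF step.prems] by simp
    qed
  qed
  then show ?thesis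
    using W_sub by unfold_locales auto
qed

section \<open>The bijection\<close>

lemma Aut_plus_leading:
  assumes "f \<in> Aut_plus"
  shows "f \<omega> \<in> V_ge 2" "pr 2 (f \<omega>) = \<omega>"
  using assms conformal_graded unfolding Aut_plus_def by auto

lemma Aut_plus_maps_to_CV_plus:
  assumes f: "f \<in> Aut_plus"
  shows "f \<omega> \<in> CV_plus"
proof -
  have Aut: "f \<in> Aut" using f by (simp add: Aut_plus_def)
  have "Z_graded_conformal_vertex_algebra scale vac nprod (\<lambda>n. f ` V n) (f \<omega>)"
    by (rule Z_graded_conformal_image[OF Aut Z_graded_conformal_vertex_algebra_axioms])
  moreover have "eigen_grading (f \<omega>) = (\<lambda>n. f ` V n)"
    by (rule ext) (simp add: eigen_grading_image[OF Aut] eigen_grading_conformal)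
  ultimately have "f \<omega> \<in> CV" by (simp add: CV_def)
  then show ?thesis using Aut_plus_leading[OF f] by (simp add: CV_plus_def)
qed

lemma Aut_plus_eqI:
  assumes f: "f \<in> Aut_plus" and g: "g \<in> Aut_plus" and eq: "f \<omega> = g \<omega>"
  shows "f = g"
proof (rule linear_eq_on_graded)
  show "Vector_Spaces.linear scale scale f" "Vector_Spaces.linear scale scale g"
    using f g by (auto simp: Aut_plus_def Aut_def)
  fix n v assume v: "v \<in> V n"
  have Aut: "f \<in> Aut" "g \<in> Aut" using f g by (auto simp: Aut_plus_def)
  have ge: "f v \<in> V_ge n" "g v \<in> V_ge n" and lead: "pr n (f v) = v" "pr n (g v) = v"
    using f g v unfolding Aut_plus_def by blast+
  have "f v \<in> eigen_grading (f \<omega>) n" "g v \<in> eigen_grading (f \<omega>) n"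
    using v eigen_grading_image[OF Aut(1), of \<omega> n] eigen_grading_image[OF Aut(2), of \<omega> n] eq
    by (auto simp: eigen_grading_conformal)
  then have "f v - g v \<in> eigen_grading (f \<omega>) n"
    by (rule subspace_diff[OF subspace_eigen_grading])
  moreover have "f v - g v \<in> V_ge (n + 1)"
    using subspace_diff[OF subspace_V_ge ge] lead by (intro V_ge_succ) (auto simp: pr_diff)
  ultimately have "f v - g v = 0"
    by (rule eigenvector_eq_0[OF Aut_plus_leading[OF f]])
  then show "f v = g v" by simp
qed

lemma CV_plus_attained:
  assumes a: "a \<in> CV_plus"
  shows "\<exists>f\<in>Aut_plus. f \<omega> = a"
proof -
  interpret W: Z_graded_conformal_vertex_algebra scale vac nprod "eigen_grading a" a
    using a by (auto simp: CV_plus_def CV_def)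
  interpret compatible_gradings scale vac nprod V "eigen_grading a"
    by (rule compatible_gradings_eigen[OF a])
  have "transfer \<omega> = a"
  proof (rule eq_if_pr_eq)
    show "transfer \<omega> \<in> eigen_grading a 2" by (rule transfer_in[OF conformal_graded])
    show "a \<in> eigen_grading a 2" by (rule W.conformal_graded)
    show "pr 2 (transfer \<omega>) = pr 2 a"
      using a pr_transfer[OF conformal_graded] by (simp add: CV_plus_def)
  qed
  then show ?thesis using transfer_in_Aut_plus by blast
qed

lemma bij_betw_Aut_plus_CV_plus: "bij_betw \<phi> Aut_plus CV_plus"
  unfolding bij_betw_def inj_on_def \<phi>_def
  using Aut_plus_eqI Aut_plus_maps_to_CV_plus CV_plus_attained by blast

lemma ex1_Aut_plus: "a \<in> CV_plus \<Longrightarrow> \<exists>!f. f \<in> Aut_plus \<and> f \<omega> = a"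
  using Aut_plus_eqI CV_plus_attained by blast

lemma \<psi>_inverse:
  assumes a: "a \<in> CV_plus"
  shows "\<psi> a \<in> Aut_plus" "\<psi> a \<omega> = a" "inv_into Aut_plus \<phi> a = \<psi> a"
proof -
  show \<psi>: "\<psi> a \<in> Aut_plus" "\<psi> a \<omega> = a"
    using theI'[OF ex1_Aut_plus[OF a]] by (auto simp: \<psi>_def)
  have "inv_into Aut_plus \<phi> (\<phi> (\<psi> a)) = \<psi> a"
    using inv_into_f_f[OF bij_betw_imp_inj_on[OF bij_betw_Aut_plus_CV_plus] \<psi>(1)] .
  then show "inv_into Aut_plus \<phi> a = \<psi> a" using \<psi> by (simp add: \<phi>_def)
qed

end


theorem corollary3p1:
  fixes vac :: "'a::ab_group_add"
    and nprod :: "'a \<Rightarrow> int \<Rightarrow> 'a \<Rightarrow> 'a"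
    and V :: "int \<Rightarrow> 'a set"
    and \<omega> :: 'a
  shows "(\<forall>scale :: real \<Rightarrow> 'a \<Rightarrow> 'a.
       Z_graded_conformal_vertex_algebra scale vac nprod V \<omega> \<longrightarrow>
       (let AutP = Z_graded_vertex_algebra.Aut_plus scale vac nprod V;
            CVP = Z_graded_conformal_vertex_algebra.CV_plus scale vac nprod V \<omega>;
            \<phi> = Z_graded_conformal_vertex_algebra.\<phi> \<omega>;
            \<psi> = Z_graded_conformal_vertex_algebra.\<psi> scale vac nprod V \<omega>
        in bij_betw \<phi> AutP CVP \<and>
           (\<forall>a\<in>CVP. \<exists>!f. f \<in> AutP \<and> f \<omega> = a) \<and>
           (\<forall>a\<in>CVP. \<psi> a \<in> AutP \<and> \<psi> a \<omega> = a \<and> inv_into AutP \<phi> a = \<psi> a)))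
   \<and> (\<forall>scale :: complex \<Rightarrow> 'a \<Rightarrow> 'a.
       Z_graded_conformal_vertex_algebra scale vac nprod V \<omega> \<longrightarrow>
       (let AutP = Z_graded_vertex_algebra.Aut_plus scale vac nprod V;
            CVP = Z_graded_conformal_vertex_algebra.CV_plus scale vac nprod V \<omega>;
            \<phi> = Z_graded_conformal_vertex_algebra.\<phi> \<omega>;
            \<psi> = Z_graded_conformal_vertex_algebra.\<psi> scale vac nprod V \<omega>
        in bij_betw \<phi> AutP CVP \<and>
           (\<forall>a\<in>CVP. \<exists>!f. f \<in> AutP \<and> f \<omega> = a) \<and>
           (\<forall>a\<in>CVP. \<psi> a \<in> AutP \<and> \<psi> a \<omega> = a \<and> inv_into AutP \<phi> a = \<psi> a)))"
  unfolding Let_def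
  by (intro conjI allI impI ballI;
      (rule Z_graded_conformal_vertex_algebra.bij_betw_Aut_plus_CV_plus
        Z_graded_conformal_vertex_algebra.ex1_Aut_plus
        Z_graded_conformal_vertex_algebra.\<psi>_inverse; assumption))

end
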